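(* Let $A$ be a random variable with values in $\{0,1\}$, $X$ a random variable with values in a set $\mathcal{X}$, and $Y$ a random variable with values in $\mathcal{Y}=\{0,1\}$, jointly distributed with $(X,A)$. Let $h:\Delta_{\mathcal{Y}}\to\mathbb{R}$ be given by $h((1-p,p))=\min(p,1-p)$ for $p\in[0,1]$. (1) Let $\hat{Y}$ be a binary classifier of $Y$ with $(X,A)$ as features. Then there is a representation of $(X,A)$, given by a random variable $Z$ on a set $\mathcal{Z}$ with $|\mathcal{Z}|=2$, such that $$\mathbb{E}_{z\sim Z}\, h(\mathbb{P}(Y\mid Z=z))\le \epsilon(\hat{Y})\quad\text{and}\quad \|\mu_0-\mu_1\|_{TV}\le D_{SP}(\hat{Y}),$$ where $\mu_a=\mathbb{P}(Z=\cdot\mid A=a)$ for $a\in\{0,1\}$. (2) Conversely, for any representation $Z$ of $(X,A)$ there is a classifier $\hat{Y}$ of $Y$, as a function of $Z$ (and thus of $(X,A)$), such that $$\epsilon(\hat{Y})\le \mathbb{E}_{z\sim Z}\, h(\mathbb{P}(Y\mid Z=z))\quad\text{and}\quad D_{SP}(\hat{Y})\le \|\mu_0-\mu_1\|_{TV},$$ where $\mu_a=\mathbb{P}(Z=\cdot\mid A=a)$ for $a\in\{0,1\}$.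
   Context: $\Delta_{\mathcal{Y}}$ is the set of probability distributions on the finite set $\mathcal{Y}$. A representation $Z$ of $(X,A)$ is a random variable with values in some space $\mathcal{Z}$, specified through a conditional distribution $\mathbb{P}(Z\mid X,A)$, and such that conditioned on $(X,A)$, $Z$ is independent of the other variables of the problem; in particular $Z\perp Y\mid (X,A)$. $\mathbb{P}(Y\mid Z=z)\in\Delta_{\mathcal{Y}}$ denotes the conditional distribution of $Y$ given $Z=z$. The total variation distance is normalized as half the $L_1$ distance: for $\mu,\nu$ with densities $f_\mu,f_\nu$ with respect to a common reference measure, $\|\mu-\nu\|_{TV}=\frac12\int|f_\mu-f_\nu|$; on a discrete set, $\|\mu-\nu\|_{TV}=\frac12\sum_z|\mu(z)-\nu(z)|$. A binary classifier $\hat{Y}$ with $(X,A)$ as features is a $\{0,1\}$-valued (possibly randomized) function of $(X,A)$, i.e. it is given by a conditional distribution $\mathbb{P}(\hat{Y}\mid X,A)$, with $\hat{Y}$ independent of $Y$ given $(X,A)$. Its prediction error is $\epsilon(\hat{Y})=\mathbb{P}(\hat{Y}\ne Y)$ and its statistical parity is $D_{SP}(\hat{Y})=\left|\mathbb{P}(\hat{Y}=1\mid A=1)-\mathbb{P}(\hat{Y}=1\mid A=0)\right|$. Both values of $A$ have positive probability. *)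

theory Defs
  imports "HOL-Probability.Probability"
begin

text \<open>
  The measurable space \<open>{0,1}\<close> in which \<open>A\<close>, \<open>Y\<close> and the predictions take their values.
  The set of probability distributions on it is \<open>space (prob_algebra bits)\<close>.
\<close>

abbreviation bits :: "nat measure" where
  "bits \<equiv> count_space {0, 1}"

definition h :: "nat measure \<Rightarrow> real" where
  "h \<mu> = min (measure \<mu> {1}) (1 - measure \<mu> {1})"

text \<open>
  A representation of \<open>(X, A)\<close> with values in \<open>N\<close> is specified by the Markov kernel
  \<open>K (x, a) = P(Z = \<cdot> | X = x, A = a)\<close>. A binary classifier, possibly randomized, is the case
  \<open>N = bits\<close>.
\<close>

definition is_representation :: "'x measure \<Rightarrow> 'z measure \<Rightarrow> ('x \<times> nat \<Rightarrow> 'z measure) \<Rightarrow> bool" where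
  "is_representation MX N K \<longleftrightarrow> K \<in> (MX \<Otimes>\<^sub>M bits) \<rightarrow>\<^sub>M prob_algebra N"

abbreviation is_classifier :: "'x measure \<Rightarrow> ('x \<times> nat \<Rightarrow> nat measure) \<Rightarrow> bool" where
  "is_classifier MX C \<equiv> is_representation MX bits C"

text \<open>
  The variable \<open>Z\<close> needs randomness that the original space \<open>M\<close> may not have, so it lives on
  \<open>M \<Otimes>\<^sub>M N\<close>: draw \<open>\<omega>\<close> from \<open>M\<close> and then \<open>Z\<close> from \<open>K (X \<omega>, A \<omega>)\<close>. Thus \<open>Z\<close> is \<open>snd\<close>,
  a variable \<open>V\<close> on \<open>M\<close> becomes \<open>V \<circ> fst\<close>, and \<open>Z\<close> depends on \<open>\<omega>\<close> only through
  \<open>(X \<omega>, A \<omega>)\<close>, which is the required conditional independence.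
\<close>

definition adjoin ::
  "'w measure \<Rightarrow> ('w \<Rightarrow> 'x) \<Rightarrow> ('w \<Rightarrow> nat) \<Rightarrow> 'z measure \<Rightarrow> ('x \<times> nat \<Rightarrow> 'z measure)
    \<Rightarrow> ('w \<times> 'z) measure" where
  "adjoin M X A N K = M \<bind> (\<lambda>\<omega>. K (X \<omega>, A \<omega>) \<bind> (\<lambda>z. return (M \<Otimes>\<^sub>M N) (\<omega>, z)))"

definition pred_error ::
  "'w measure \<Rightarrow> ('w \<Rightarrow> 'x) \<Rightarrow> ('w \<Rightarrow> nat) \<Rightarrow> ('w \<Rightarrow> nat) \<Rightarrow> ('x \<times> nat \<Rightarrow> nat measure) \<Rightarrow> real" where
  "pred_error M X A Y C = \<P>(w in adjoin M X A bits C. snd w \<noteq> Y (fst w))"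

definition stat_parity ::
  "'w measure \<Rightarrow> ('w \<Rightarrow> 'x) \<Rightarrow> ('w \<Rightarrow> nat) \<Rightarrow> ('x \<times> nat \<Rightarrow> nat measure) \<Rightarrow> real" where
  "stat_parity M X A C =
    \<bar>\<P>(w in adjoin M X A bits C. snd w = 1 \<bar> A (fst w) = 1)
     - \<P>(w in adjoin M X A bits C. snd w = 1 \<bar> A (fst w) = 0)\<bar>"

text \<open>The distribution \<open>\<mu>\<^sub>a = P(Z = \<cdot> | A = a)\<close>.\<close>

definition group_dist ::
  "'w measure \<Rightarrow> ('w \<Rightarrow> 'x) \<Rightarrow> ('w \<Rightarrow> nat) \<Rightarrow> 'z measure \<Rightarrow> ('x \<times> nat \<Rightarrow> 'z measure)
    \<Rightarrow> nat \<Rightarrow> 'z measure" where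
  "group_dist M X A N K a =
    (let P = adjoin M X A N K
     in distr (uniform_measure P {w \<in> space P. A (fst w) = a}) N snd)"

text \<open>
  \<open>\<kappa>\<close> is a version of \<open>z \<mapsto> P(V = \<cdot> | Z = z)\<close> for random variables \<open>V\<close>, \<open>Z\<close> on \<open>P\<close> with \<open>V\<close>
  binary. Versions exist (\<open>cond_dist_exists\<close> below) and agree almost everywhere with respect to the
  law of \<open>Z\<close>.
\<close>

definition cond_dist ::
  "'p measure \<Rightarrow> ('p \<Rightarrow> nat) \<Rightarrow> 'z measure \<Rightarrow> ('p \<Rightarrow> 'z) \<Rightarrow> ('z \<Rightarrow> nat measure) \<Rightarrow> bool" where
  "cond_dist P V N Z \<kappa> \<longleftrightarrow>
    \<kappa> \<in> N \<rightarrow>\<^sub>M prob_algebra bits \<and>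
    (\<forall>B\<in>sets N. \<forall>E\<in>sets bits.
      emeasure P {w \<in> space P. Z w \<in> B \<and> V w \<in> E}
        = (\<integral>\<^sup>+z\<in>B. emeasure (\<kappa> z) E \<partial>distr P N Z))"

definition sum_measure :: "'a measure \<Rightarrow> 'a measure \<Rightarrow> 'a measure" where
  "sum_measure \<mu> \<nu> = measure_of (space \<mu>) (sets \<mu>) (\<lambda>B. emeasure \<mu> B + emeasure \<nu> B)"

text \<open>
  The sum of the two measures serves as reference measure; by \<open>tv_dist_density\<close> below, any other
  common reference measure gives the same value.
\<close>

definition tv_dist :: "'a measure \<Rightarrow> 'a measure \<Rightarrow> real" where
  "tv_dist \<mu> \<nu> =
    1 / 2 * (\<integral>x. \<bar>enn2real (RN_deriv (sum_measure \<mu> \<nu>) \<mu> x)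
                   - enn2real (RN_deriv (sum_measure \<mu> \<nu>) \<nu> x)\<bar> \<partial>sum_measure \<mu> \<nu>)"

lemma space_sum_measure [simp]: "space (sum_measure \<mu> \<nu>) = space \<mu>"
  and sets_sum_measure [simp, measurable_cong]: "sets (sum_measure \<mu> \<nu>) = sets \<mu>"
  by (auto simp: sum_measure_def)

lemma emeasure_sum_measure:
  assumes "sets \<nu> = sets \<mu>" and "B \<in> sets \<mu>"
  shows "emeasure (sum_measure \<mu> \<nu>) B = emeasure \<mu> B + emeasure \<nu> B"
proof (rule emeasure_measure_of[OF sum_measure_def])
  show "countably_additive (sets (sum_measure \<mu> \<nu>)) (\<lambda>B. emeasure \<mu> B + emeasure \<nu> B)"
  proof (rule countably_additiveI, goal_cases)
    case (1 F)
    with assms have "range F \<subseteq> sets \<mu>" "range F \<subseteq> sets \<nu>" by auto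
    with 1 show ?case
      by (subst suminf_add[symmetric]) (auto simp: suminf_emeasure)
  qed
qed (use assms sets.sets_into_space in \<open>auto simp: positive_def\<close>)

lemma tv_dist_density:
  assumes f [measurable]: "f \<in> borel_measurable R" and g [measurable]: "g \<in> borel_measurable R"
    and f0: "\<And>x. 0 \<le> f x" and g0: "\<And>x. 0 \<le> g x"
    and pf: "prob_space (density R (\<lambda>x. ennreal (f x)))"
    and pg: "prob_space (density R (\<lambda>x. ennreal (g x)))"
  shows "tv_dist (density R (\<lambda>x. ennreal (f x))) (density R (\<lambda>x. ennreal (g x)))
          = 1 / 2 * (\<integral>x. \<bar>f x - g x\<bar> \<partial>R)"
proof -
  define \<mu> where "\<mu> = density R (\<lambda>x. ennreal (f x))"
  define \<nu> where "\<nu> = density R (\<lambda>x. ennreal (g x))"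
  define S where "S = sum_measure \<mu> \<nu>"
  have S: "S = density R (\<lambda>x. ennreal (f x + g x))"
  proof (rule measure_eqI)
    fix B assume "B \<in> sets S"
    then have B: "B \<in> sets R" by (simp add: S_def \<mu>_def)
    then show "emeasure S B = emeasure (density R (\<lambda>x. ennreal (f x + g x))) B"
      by (simp add: S_def emeasure_sum_measure \<mu>_def \<nu>_def emeasure_density f0 g0
          nn_integral_add[symmetric] ennreal_plus ring_distribs)
  qed (simp add: S_def \<mu>_def)
  interpret S: finite_measure S
  proof
    have "emeasure S (space S) = emeasure \<mu> (space \<mu>) + emeasure \<nu> (space \<nu>)"
      by (simp add: S_def emeasure_sum_measure \<mu>_def \<nu>_def)
    also have "\<dots> = 2"
      using pf pg by (simp add: \<mu>_def \<nu>_def prob_space.emeasure_space_1 del: space_density)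
    finally show "emeasure S (space S) \<noteq> \<infinity>" by simp
  qed
  have RN: "AE x in R. ennreal (f x + g x) * RN_deriv S \<tau> x = ennreal (k x)"
    if \<tau>: "\<tau> = density R (\<lambda>x. ennreal (k x))" and k [measurable]: "k \<in> borel_measurable R"
      and le: "\<And>x. 0 \<le> k x \<and> k x \<le> f x + g x" and pk: "prob_space \<tau>" for k \<tau>
  proof -
    have ac: "absolutely_continuous S \<tau>"
      unfolding absolutely_continuous_def S \<tau>
    proof safe
      fix B assume "B \<in> null_sets (density R (\<lambda>x. ennreal (f x + g x)))"
      then have "B \<in> sets R" "AE x in R. x \<in> B \<longrightarrow> f x + g x \<le> 0"
        by (auto simp: null_sets_density_iff ennreal_eq_0_iff)
      then show "B \<in> null_sets (density R (\<lambda>x. ennreal (k x)))"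
        using le by (auto simp: null_sets_density_iff ennreal_eq_0_iff elim!: eventually_mono
            intro: order_trans)
    qed
    have [measurable]: "RN_deriv S \<tau> \<in> borel_measurable R"
      using borel_measurable_RN_deriv[of S \<tau>] by (simp add: S)
    have "density R (\<lambda>x. ennreal (f x + g x) * RN_deriv S \<tau> x) = density S (RN_deriv S \<tau>)"
      by (subst (2) S) (simp add: density_density_eq)
    also have "\<dots> = \<tau>"
      by (rule S.density_RN_deriv[OF ac]) (simp add: S \<tau>)
    finally have *: "density R (\<lambda>x. ennreal (f x + g x) * RN_deriv S \<tau> x)
        = density R (\<lambda>x. ennreal (k x))" using \<tau> by simp
    have "sigma_finite_measure (density R (\<lambda>x. ennreal (f x + g x) * RN_deriv S \<tau> x))"
      by (subst *) (use pk in \<open>simp add: \<tau> prob_space_imp_sigma_finite\<close>)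
    from iffD1[OF sigma_finite_density_unique[OF _ _ this] *] show ?thesis by measurable
  qed
  have 1: "AE x in R. ennreal (f x + g x) * RN_deriv S \<mu> x = ennreal (f x)"
    by (rule RN) (use f0 g0 pf in \<open>auto simp: \<mu>_def\<close>)
  have 2: "AE x in R. ennreal (f x + g x) * RN_deriv S \<nu> x = ennreal (g x)"
    by (rule RN) (use f0 g0 pg in \<open>auto simp: \<nu>_def\<close>)
  have [measurable]: "RN_deriv S \<mu> \<in> borel_measurable R" "RN_deriv S \<nu> \<in> borel_measurable R"
    using borel_measurable_RN_deriv[of S \<mu>] borel_measurable_RN_deriv[of S \<nu>] by (simp_all add: S)
  have int_S: "(\<integral>x. F x \<partial>S) = (\<integral>x. (f x + g x) * F x \<partial>R)"
    if [measurable]: "F \<in> borel_measurable R" for F :: "'a \<Rightarrow> real"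
    unfolding S by (subst integral_density) (use f0 g0 in \<open>auto simp: add_nonneg_nonneg\<close>)
  have "(\<integral>x. \<bar>enn2real (RN_deriv S \<mu> x) - enn2real (RN_deriv S \<nu> x)\<bar> \<partial>S)
      = (\<integral>x. (f x + g x) * \<bar>enn2real (RN_deriv S \<mu> x) - enn2real (RN_deriv S \<nu> x)\<bar> \<partial>R)"
    by (rule int_S) measurable
  also have "\<dots> = (\<integral>x. \<bar>f x - g x\<bar> \<partial>R)"
  proof (rule integral_cong_AE)
    show "AE x in R. (f x + g x) * \<bar>enn2real (RN_deriv S \<mu> x) - enn2real (RN_deriv S \<nu> x)\<bar>
        = \<bar>f x - g x\<bar>"
      using 1 2
    proof eventually_elim
      case (elim x)
      have "f x = (f x + g x) * enn2real (RN_deriv S \<mu> x)"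
        using arg_cong[OF elim(1), of enn2real] f0[of x] g0[of x] by (simp add: enn2real_mult del: ennreal_plus)
      moreover have "g x = (f x + g x) * enn2real (RN_deriv S \<nu> x)"
        using arg_cong[OF elim(2), of enn2real] f0[of x] g0[of x] by (simp add: enn2real_mult del: ennreal_plus)
      ultimately have "f x - g x
          = (f x + g x) * (enn2real (RN_deriv S \<mu> x) - enn2real (RN_deriv S \<nu> x))"
        by (simp add: right_diff_distrib)
      then show ?case using f0[of x] g0[of x] by (simp add: abs_mult)
    qed
  qed measurable
  finally show ?thesis by (simp add: tv_dist_def S_def \<mu>_def \<nu>_def)
qed

lemma adjoin_kernel:
  assumes [measurable]: "X \<in> M \<rightarrow>\<^sub>M MX" "A \<in> M \<rightarrow>\<^sub>M bits" and "is_representation MX N K"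
  shows "(\<lambda>\<omega>. K (X \<omega>, A \<omega>) \<bind> (\<lambda>z. return (M \<Otimes>\<^sub>M N) (\<omega>, z)))
    \<in> M \<rightarrow>\<^sub>M prob_algebra (M \<Otimes>\<^sub>M N)"
proof -
  have [measurable]: "K \<in> (MX \<Otimes>\<^sub>M bits) \<rightarrow>\<^sub>M prob_algebra N"
    using assms(3) by (simp add: is_representation_def)
  show ?thesis by measurable
qed

lemma adjoin_in_prob_algebra:
  assumes "prob_space M" "X \<in> M \<rightarrow>\<^sub>M MX" "A \<in> M \<rightarrow>\<^sub>M bits" "is_representation MX N K"
  shows "adjoin M X A N K \<in> space (prob_algebra (M \<Otimes>\<^sub>M N))"
proof -
  have "M \<in> space (prob_algebra M)" using assms(1) by (simp add: space_prob_algebra)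
  from prob_space_bind'[OF this adjoin_kernel[OF assms(2-4)]]
    sets_bind'[OF this adjoin_kernel[OF assms(2-4)]]
  show ?thesis by (simp add: adjoin_def space_prob_algebra)
qed

lemma cond_dist_exists:
  assumes P: "prob_space P" and Z [measurable]: "Z \<in> P \<rightarrow>\<^sub>M N"
    and V [measurable]: "V \<in> P \<rightarrow>\<^sub>M bits"
  shows "\<exists>\<kappa>. cond_dist P V N Z \<kappa>"
proof -
  interpret P: prob_space P by (rule P)
  define L where "L = distr P N Z"
  define LV where "LV y = distr (density P (indicator (V -` {y} \<inter> space P))) N Z" for y
  define f where "f y = RN_deriv L (LV y)" for y
  interpret L: prob_space L unfolding L_def by (rule P.prob_space_distr) measurable
  have [simp, measurable_cong]: "sets L = sets N" by (simp add: L_def)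
  have [measurable]: "f y \<in> borel_measurable N" for y
    using borel_measurable_RN_deriv[of L "LV y"] by (simp add: f_def)
  have LV: "emeasure (LV y) B = emeasure P {w \<in> space P. Z w \<in> B \<and> V w = y}"
    if y: "y \<in> {0, 1}" and B [measurable]: "B \<in> sets N" for y B
  proof -
    have [measurable]: "V -` {y} \<inter> space P \<in> sets P"
      using y by (intro measurable_sets[OF V]) auto
    have "emeasure (LV y) B = emeasure P ((V -` {y} \<inter> space P) \<inter> (Z -` B \<inter> space P))"
      by (simp add: LV_def emeasure_distr emeasure_density nn_integral_indicator
          flip: indicator_inter_arith)
    also have "(V -` {y} \<inter> space P) \<inter> (Z -` B \<inter> space P)
        = {w \<in> space P. Z w \<in> B \<and> V w = y}" by auto
    finally show ?thesis .
  qed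
  have Lf: "density L (f y) = LV y" if y: "y \<in> {0, 1}" for y
    unfolding f_def
  proof (rule L.density_RN_deriv)
    show "absolutely_continuous L (LV y)"
      unfolding absolutely_continuous_def
    proof
      fix B assume B0: "B \<in> null_sets L"
      then have B [measurable]: "B \<in> sets N" by auto
      have "emeasure (LV y) B \<le> emeasure P (Z -` B \<inter> space P)"
        unfolding LV[OF y B] by (rule emeasure_mono) auto
      also have "\<dots> = 0" using B0 by (auto simp: L_def emeasure_distr)
      finally show "B \<in> null_sets (LV y)" by (simp add: null_sets_def LV_def)
    qed
  qed (simp add: LV_def)
  have V01: "V w = 0 \<or> V w = Suc 0" if "w \<in> space P" for w
    using measurable_space[OF V that] by simp
  have "density L (\<lambda>z. f 0 z + f 1 z) = density L (\<lambda>_. 1)"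
  proof (rule measure_eqI)
    fix B assume "B \<in> sets (density L (\<lambda>z. f 0 z + f 1 z))"
    then have B [measurable]: "B \<in> sets N" by simp
    have "emeasure (density L (\<lambda>z. f 0 z + f 1 z)) B
        = emeasure (density L (f 0)) B + emeasure (density L (f 1)) B"
      by (simp add: emeasure_density nn_integral_add[symmetric] ring_distribs)
    also have "\<dots> = emeasure P {w \<in> space P. Z w \<in> B \<and> V w = 0}
        + emeasure P {w \<in> space P. Z w \<in> B \<and> V w = 1}"
      using LV[of 0 B] LV[of 1 B] Lf[of 0] Lf[of 1] by simp
    also have "\<dots> = emeasure P ({w \<in> space P. Z w \<in> B \<and> V w = 0}
        \<union> {w \<in> space P. Z w \<in> B \<and> V w = 1})"
      by (rule plus_emeasure) auto
    also have "{w \<in> space P. Z w \<in> B \<and> V w = 0} \<union> {w \<in> space P. Z w \<in> B \<and> V w = 1}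
        = Z -` B \<inter> space P" using V01 by auto
    finally show "emeasure (density L (\<lambda>z. f 0 z + f 1 z)) B = emeasure (density L (\<lambda>_. 1)) B"
      by (simp add: L_def emeasure_distr emeasure_density)
  qed simp
  then have f01: "AE z in L. f 0 z + f 1 z = 1"
    by (subst (asm) L.density_unique_iff) auto
  define \<kappa> where "\<kappa> z = (if f 0 z + f 1 z = 1 then density bits (\<lambda>y. f y z) else return bits 0)" for z
  have \<kappa>: "emeasure (\<kappa> z) E = (if f 0 z + f 1 z = 1 then \<Sum>y\<in>E. f y z else indicator E 0)"
    if "E \<subseteq> {0, 1}" for z E
    using that finite_subset[OF that]
    by (auto simp: \<kappa>_def emeasure_density nn_integral_count_space_finite
        sum.inter_restrict[symmetric] Int_absorb1 indicator_def sum.If_cases if_distrib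
        mult.commute cong: if_cong intro!: sum.mono_neutral_cong_right)
  have \<kappa>_meas: "\<kappa> \<in> N \<rightarrow>\<^sub>M prob_algebra bits"
  proof (rule measurable_prob_algebraI)
    have sp: "space (\<kappa> z) = {0, 1}" for z by (simp add: \<kappa>_def)
    show ps: "prob_space (\<kappa> z)" for z
      by (rule prob_spaceI) (unfold sp, subst \<kappa>, auto)
    show "\<kappa> \<in> N \<rightarrow>\<^sub>M subprob_algebra bits"
    proof (rule measurable_subprob_algebra)
      show "subprob_space (\<kappa> z)" for z using ps by (rule prob_space_imp_subprob_space)
      fix E assume "E \<in> sets bits"
      then have "E \<subseteq> {0, 1}" by simp
      then show "(\<lambda>z. emeasure (\<kappa> z) E) \<in> borel_measurable N"
        by (subst \<kappa>) measurable
    qed (simp add: \<kappa>_def)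
  qed
  have "emeasure P {w \<in> space P. Z w \<in> B \<and> V w \<in> E} = (\<integral>\<^sup>+z\<in>B. emeasure (\<kappa> z) E \<partial>L)"
    if B [measurable]: "B \<in> sets N" and E: "E \<subseteq> {0, 1}" for B E
  proof -
    have fin: "finite E" using E by (rule finite_subset) simp
    have meas: "{w \<in> space P. Z w \<in> B \<and> V w = y} \<in> sets P" if "y \<in> E" for y
    proof -
      have "(Z -` B \<inter> space P) \<inter> (V -` {y} \<inter> space P) \<in> sets P"
        using that E by (intro sets.Int measurable_sets[OF V] measurable_sets[OF Z]) auto
      then show ?thesis by (rule back_subst) auto
    qed
    have "(\<integral>\<^sup>+z\<in>B. emeasure (\<kappa> z) E \<partial>L) = (\<integral>\<^sup>+z. (\<Sum>y\<in>E. f y z * indicator B z) \<partial>L)"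
      using f01 by (intro nn_integral_cong_AE)
        (auto elim!: eventually_mono simp: \<kappa>[OF E] sum_distrib_right)
    also have "\<dots> = (\<Sum>y\<in>E. emeasure (density L (f y)) B)"
      by (subst nn_integral_sum) (auto simp: emeasure_density)
    also have "\<dots> = (\<Sum>y\<in>E. emeasure P {w \<in> space P. Z w \<in> B \<and> V w = y})"
      using E by (intro sum.cong) (auto simp: Lf LV)
    also have "\<dots> = emeasure P (\<Union>y\<in>E. {w \<in> space P. Z w \<in> B \<and> V w = y})"
      using fin meas by (intro sum_emeasure) (auto simp: disjoint_family_on_def)
    also have "(\<Union>y\<in>E. {w \<in> space P. Z w \<in> B \<and> V w = y}) = {w \<in> space P. Z w \<in> B \<and> V w \<in> E}"
      by auto
    finally show ?thesis by simp
  qed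
  with \<kappa>_meas show ?thesis
    unfolding cond_dist_def L_def by (intro exI[of _ \<kappa>]) auto
qed

end

theory Submission
  imports Defs
begin

text \<open>
  If \<open>g z\<close> is used to guess a binary \<open>V\<close> from \<open>Z = z\<close>, the probability of error is the expectation
  of \<open>P(V = 1 - g z | Z = z)\<close>. The integrand is always at least \<open>h (P(V = \<cdot> | Z = z))\<close>, with
  equality when \<open>g z\<close> is the more likely label. For (1) take \<open>Z\<close> to be the classifier itself and
  guess by the identity; total variation on two points is the difference of the masses at 1. For
  (2) take the Bayes guess; its statistical parity is \<open>\<bar>\<mu>\<^sub>0 B - \<mu>\<^sub>1 B\<bar>\<close> with
  \<open>B = g\<^sup>-\<^sup>1(1)\<close>, which the total variation bounds.
\<close>

section \<open>The law of a variable adjoined through a kernel\<close>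

lemma
  assumes "prob_space M" "X \<in> M \<rightarrow>\<^sub>M MX" "A \<in> M \<rightarrow>\<^sub>M bits" "is_representation MX N K"
  shows prob_space_adjoin: "prob_space (adjoin M X A N K)"
    and sets_adjoin: "sets (adjoin M X A N K) = sets (M \<Otimes>\<^sub>M N)"
  using adjoin_in_prob_algebra[OF assms] by (auto simp: space_prob_algebra)

text \<open>The two binds become two integrals, and the inner Dirac measure at
  \<open>(\<omega>, z)\<close> turns the mass of \<open>D\<close> into the indicator of its section
  at \<omega>. Identities between laws on the enlarged space thus reduce to identities between
  masses of sections.\<close>

lemma emeasure_adjoin:
  assumes M: "prob_space M" and [measurable]: "X \<in> M \<rightarrow>\<^sub>M MX" "A \<in> M \<rightarrow>\<^sub>M bits"
    and K: "is_representation MX N K" and D [measurable]: "D \<in> sets (M \<Otimes>\<^sub>M N)"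
  shows "emeasure (adjoin M X A N K) D = (\<integral>\<^sup>+\<omega>. emeasure (K (X \<omega>, A \<omega>)) (Pair \<omega> -` D) \<partial>M)"
proof -
  have [measurable]: "K \<in> (MX \<Otimes>\<^sub>M bits) \<rightarrow>\<^sub>M prob_algebra N"
    using K by (simp add: is_representation_def)
  have "M \<in> space (prob_algebra M)" using M by (simp add: space_prob_algebra)
  from emeasure_bind_prob_algebra[OF this adjoin_kernel[OF assms(2,3) K] D]
  have "emeasure (adjoin M X A N K) D
      = (\<integral>\<^sup>+\<omega>. emeasure (K (X \<omega>, A \<omega>) \<bind> (\<lambda>z. return (M \<Otimes>\<^sub>M N) (\<omega>, z))) D \<partial>M)"
    by (simp add: adjoin_def)
  also have "\<dots> = (\<integral>\<^sup>+\<omega>. emeasure (K (X \<omega>, A \<omega>)) (Pair \<omega> -` D) \<partial>M)"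
  proof (rule nn_integral_cong)
    fix \<omega> assume \<omega> [measurable]: "\<omega> \<in> space M"
    have "(X \<omega>, A \<omega>) \<in> space (MX \<Otimes>\<^sub>M bits)"
      using \<omega> measurable_space[OF assms(2)] measurable_space[OF assms(3)]
      by (auto simp: space_pair_measure)
    then have Kin: "K (X \<omega>, A \<omega>) \<in> space (prob_algebra N)"
      by (rule measurable_space[rotated]) measurable
    then have sK [measurable_cong]: "sets (K (X \<omega>, A \<omega>)) = sets N"
      by (simp add: space_prob_algebra)
    have "emeasure (K (X \<omega>, A \<omega>) \<bind> (\<lambda>z. return (M \<Otimes>\<^sub>M N) (\<omega>, z))) D
        = (\<integral>\<^sup>+z. emeasure (return (M \<Otimes>\<^sub>M N) (\<omega>, z)) D \<partial>K (X \<omega>, A \<omega>))"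
      by (rule emeasure_bind_prob_algebra[OF Kin _ D]) measurable
    also have "\<dots> = (\<integral>\<^sup>+z. indicator (Pair \<omega> -` D) z \<partial>K (X \<omega>, A \<omega>))"
      by (intro nn_integral_cong) (simp add: indicator_def)
    also have "\<dots> = emeasure (K (X \<omega>, A \<omega>)) (Pair \<omega> -` D)"
      by (rule nn_integral_indicator) (simp add: sK sets_Pair1[OF D])
    finally show "emeasure (K (X \<omega>, A \<omega>) \<bind> (\<lambda>z. return (M \<Otimes>\<^sub>M N) (\<omega>, z))) D
        = emeasure (K (X \<omega>, A \<omega>)) (Pair \<omega> -` D)" .
  qed
  finally show ?thesis .
qed

lemma is_representation_distr:
  assumes "is_representation MX N K" and [measurable]: "g \<in> N \<rightarrow>\<^sub>M N'"
  shows "is_representation MX N' (\<lambda>xa. distr (K xa) N' g)"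
proof -
  have [measurable]: "K \<in> (MX \<Otimes>\<^sub>M bits) \<rightarrow>\<^sub>M prob_algebra N"
    using assms(1) by (simp add: is_representation_def)
  show ?thesis unfolding is_representation_def by measurable
qed

text \<open>By the section formula both sides integrate the same function of \<omega>. The purpose
  is to carry a classifier computed from \<open>Z\<close> by \<open>g\<close> back to the space on
  which \<open>Z\<close> itself lives, where the conditional distribution of \<open>Y\<close> given
  \<open>Z\<close> can be used.\<close>

lemma adjoin_distr:
  assumes M: "prob_space M" and X: "X \<in> M \<rightarrow>\<^sub>M MX" and A: "A \<in> M \<rightarrow>\<^sub>M bits"
    and K: "is_representation MX N K" and g [measurable]: "g \<in> N \<rightarrow>\<^sub>M N'"
  shows "adjoin M X A N' (\<lambda>xa. distr (K xa) N' g)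
    = distr (adjoin M X A N K) (M \<Otimes>\<^sub>M N') (\<lambda>(\<omega>, z). (\<omega>, g z))" (is "?L = ?R")
proof (rule measure_eqI)
  note K' = is_representation_distr[OF K g]
  have sP [measurable_cong]: "sets (adjoin M X A N K) = sets (M \<Otimes>\<^sub>M N)"
    by (rule sets_adjoin[OF M X A K])
  show "sets ?L = sets ?R"
    by (simp add: sets_adjoin[OF M X A K'])
  fix D assume "D \<in> sets ?L"
  then have D [measurable]: "D \<in> sets (M \<Otimes>\<^sub>M N')"
    by (simp add: sets_adjoin[OF M X A K'])
  let ?G = "\<lambda>(\<omega>, z). (\<omega>, g z)"
  have GD: "?G -` D \<inter> space (M \<Otimes>\<^sub>M N) \<in> sets (M \<Otimes>\<^sub>M N)"
    by measurable
  have "emeasure ?R D = emeasure (adjoin M X A N K) (?G -` D \<inter> space (M \<Otimes>\<^sub>M N))"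
    by (subst emeasure_distr) (auto simp: sets_eq_imp_space_eq[OF sP])
  also have "\<dots> = (\<integral>\<^sup>+\<omega>. emeasure (K (X \<omega>, A \<omega>)) (Pair \<omega> -` (?G -` D \<inter> space (M \<Otimes>\<^sub>M N))) \<partial>M)"
    by (rule emeasure_adjoin[OF M X A K GD])
  also have "\<dots> = (\<integral>\<^sup>+\<omega>. emeasure (distr (K (X \<omega>, A \<omega>)) N' g) (Pair \<omega> -` D) \<partial>M)"
  proof (rule nn_integral_cong)
    fix \<omega> assume \<omega>: "\<omega> \<in> space M"
    have "(X \<omega>, A \<omega>) \<in> space (MX \<Otimes>\<^sub>M bits)"
      using measurable_space[OF X \<omega>] measurable_space[OF A \<omega>]
      by (auto simp: space_pair_measure)
    then have sK [measurable_cong]: "sets (K (X \<omega>, A \<omega>)) = sets N"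
      using measurable_space[OF K[unfolded is_representation_def]]
      by (simp add: space_prob_algebra)
    \<comment> \<open>Within \<open>space N\<close>, the section at \<omega> of the preimage of
      \<open>D\<close> is the preimage under \<open>g\<close> of the section of
      \<open>D\<close>.\<close>
    show "emeasure (K (X \<omega>, A \<omega>)) (Pair \<omega> -` (?G -` D \<inter> space (M \<Otimes>\<^sub>M N)))
        = emeasure (distr (K (X \<omega>, A \<omega>)) N' g) (Pair \<omega> -` D)"
      using \<omega> by (subst emeasure_distr)
        (auto simp: sets_Pair1[OF D] space_pair_measure sets_eq_imp_space_eq[OF sK]
          intro!: arg_cong[where f = "emeasure (K (X \<omega>, A \<omega>))"])
  qed
  also have "\<dots> = emeasure ?L D"
    by (rule emeasure_adjoin[OF M X A K' D, symmetric])
  finally show "emeasure ?L D = emeasure ?R D" ..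
qed

text \<open>Each \<open>K (X \<omega>, A \<omega>)\<close> has total mass one, so the cylinder over
  \<open>B\<close> has the mass of \<open>B\<close>. Events about the original variables, such as
  \<open>A = a\<close>, therefore keep their probability.\<close>

lemma distr_adjoin_fst:
  assumes M: "prob_space M" and X: "X \<in> M \<rightarrow>\<^sub>M MX" and A: "A \<in> M \<rightarrow>\<^sub>M bits"
    and K: "is_representation MX N K"
  shows "distr (adjoin M X A N K) M fst = M"
proof (rule measure_eqI)
  fix B assume "B \<in> sets (distr (adjoin M X A N K) M fst)"
  then have B [measurable]: "B \<in> sets M" by simp
  have sP [measurable_cong]: "sets (adjoin M X A N K) = sets (M \<Otimes>\<^sub>M N)"
    by (rule sets_adjoin[OF M X A K])
  have "emeasure (distr (adjoin M X A N K) M fst) B = emeasure (adjoin M X A N K) (B \<times> space N)"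
    using sets.sets_into_space[OF B]
    by (subst emeasure_distr)
      (auto simp: sets_eq_imp_space_eq[OF sP] space_pair_measure
        intro!: arg_cong[where f = "emeasure (adjoin M X A N K)"])
  also have "\<dots> = (\<integral>\<^sup>+\<omega>. emeasure (K (X \<omega>, A \<omega>)) (Pair \<omega> -` (B \<times> space N)) \<partial>M)"
    by (rule emeasure_adjoin[OF M X A K]) measurable
  also have "\<dots> = (\<integral>\<^sup>+\<omega>. indicator B \<omega> \<partial>M)"
  proof (rule nn_integral_cong)
    fix \<omega> assume \<omega>: "\<omega> \<in> space M"
    have "(X \<omega>, A \<omega>) \<in> space (MX \<Otimes>\<^sub>M bits)"
      using measurable_space[OF X \<omega>] measurable_space[OF A \<omega>]
      by (auto simp: space_pair_measure)
    then have "K (X \<omega>, A \<omega>) \<in> space (prob_algebra N)"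
      by (rule measurable_space[OF K[unfolded is_representation_def]])
    then have "space N = space (K (X \<omega>, A \<omega>))" "prob_space (K (X \<omega>, A \<omega>))"
      by (auto simp: space_prob_algebra dest: sets_eq_imp_space_eq)
    then show "emeasure (K (X \<omega>, A \<omega>)) (Pair \<omega> -` (B \<times> space N)) = indicator B \<omega>"
      by (auto simp: indicator_def prob_space.emeasure_space_1)
  qed
  finally show "emeasure (distr (adjoin M X A N K) M fst) B = emeasure M B" by simp
qed simp

section \<open>Total variation: densities, the bound on events, the two-point case\<close>

text \<open>Total variation is defined through \<open>enn2real\<close> of the derivative, which
  sends infinity to 0. The derivative of a finite measure is finite almost everywhere, so nothing is
  lost and the Radon-Nikodym identity carries over to Bochner integrals.\<close>

lemma integrable_RN_deriv:
  assumes "finite_measure S" "finite_measure \<mu>" "absolutely_continuous S \<mu>" "sets \<mu> = sets S"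
  shows "integrable S (\<lambda>x. enn2real (RN_deriv S \<mu> x))"
    and "B \<in> sets S \<Longrightarrow> (\<integral>x. indicator B x * enn2real (RN_deriv S \<mu> x) \<partial>S) = measure \<mu> B"
proof -
  interpret S: finite_measure S by fact
  interpret \<mu>: finite_measure \<mu> by fact
  have d: "density S (RN_deriv S \<mu>) = \<mu>" by (rule S.density_RN_deriv) fact+
  have fin: "AE x in S. RN_deriv S \<mu> x \<noteq> \<infinity>"
    by (rule S.RN_deriv_finite) (use assms \<mu>.sigma_finite_measure_axioms in simp_all)
  have emeas: "(\<integral>\<^sup>+x. ennreal (indicator B x * enn2real (RN_deriv S \<mu> x)) \<partial>S) = emeasure \<mu> B"
    if "B \<in> sets S" for B
  proof -
    have "(\<integral>\<^sup>+x. ennreal (indicator B x * enn2real (RN_deriv S \<mu> x)) \<partial>S)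
        = (\<integral>\<^sup>+x. RN_deriv S \<mu> x * indicator B x \<partial>S)"
      using fin by (intro nn_integral_cong_AE)
        (auto elim!: eventually_mono simp: indicator_def less_top)
    also have "\<dots> = emeasure (density S (RN_deriv S \<mu>)) B"
      using that by (simp add: emeasure_density)
    finally show ?thesis by (simp add: d)
  qed
  show "(\<integral>x. indicator B x * enn2real (RN_deriv S \<mu> x) \<partial>S) = measure \<mu> B"
    if B: "B \<in> sets S" for B
    using B by (subst integral_eq_nn_integral) (auto simp: emeas measure_def)
  show "integrable S (\<lambda>x. enn2real (RN_deriv S \<mu> x))"
  proof (rule integrableI_nonneg)
    \<comment> \<open>Taking the whole space for \<open>B\<close> in \<open>emeas\<close> reduces
      integrability to the finiteness of \<mu>.\<close>
    have "(\<integral>\<^sup>+x. ennreal (enn2real (RN_deriv S \<mu> x)) \<partial>S)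
      = (\<integral>\<^sup>+x. ennreal (indicator (space S) x * enn2real (RN_deriv S \<mu> x)) \<partial>S)"
      by (intro nn_integral_cong) simp
    then show "(\<integral>\<^sup>+x. ennreal (enn2real (RN_deriv S \<mu> x)) \<partial>S) < \<infinity>"
      by (simp add: emeas less_top[symmetric])
  qed auto
qed

text \<open>The total masses agree, so the differences of the two measures on \<open>B\<close> and
  on its complement are opposite numbers. Each is bounded in absolute value by the integral of
  \<open>\<bar>f - g\<bar>\<close> over its own part; adding the two bounds yields a factor 2, which
  the one half in the definition absorbs.\<close>

lemma abs_measure_diff_le_tv_dist:
  assumes \<mu>: "prob_space \<mu>" and \<nu>: "prob_space \<nu>" and sets: "sets \<nu> = sets \<mu>"
    and B: "B \<in> sets \<mu>"
  shows "\<bar>measure \<mu> B - measure \<nu> B\<bar> \<le> tv_dist \<mu> \<nu>"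
proof -
  interpret \<mu>: prob_space \<mu> by fact
  interpret \<nu>: prob_space \<nu> by fact
  define S where "S = sum_measure \<mu> \<nu>"
  have em: "emeasure S D = emeasure \<mu> D + emeasure \<nu> D" if "D \<in> sets \<mu>" for D
    unfolding S_def using sets that by (rule emeasure_sum_measure)
  have sS: "sets S = sets \<mu>" "space S = space \<mu>" "space \<nu> = space \<mu>"
    using sets_eq_imp_space_eq[OF sets] by (simp_all add: S_def)
  have fS: "finite_measure S"
    by (rule finite_measureI) (simp add: em sS \<mu>.emeasure_space_1 \<nu>.emeasure_finite)
  \<comment> \<open>A sum of two nonnegative masses vanishes only if both do.\<close>
  have ac: "absolutely_continuous S \<mu>" "absolutely_continuous S \<nu>"
    by (auto simp: absolutely_continuous_def null_sets_def em sets sS)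
  define f where "f x = enn2real (RN_deriv S \<mu> x)" for x
  define g where "g x = enn2real (RN_deriv S \<nu> x)" for x
  have f: "integrable S f" "D \<in> sets \<mu> \<Longrightarrow> (\<integral>x. indicator D x * f x \<partial>S) = measure \<mu> D" for D
    using integrable_RN_deriv[OF fS \<mu>.finite_measure_axioms ac(1)] by (auto simp: sS f_def[abs_def])
  have g: "integrable S g" "D \<in> sets \<mu> \<Longrightarrow> (\<integral>x. indicator D x * g x \<partial>S) = measure \<nu> D" for D
    using integrable_RN_deriv[OF fS \<nu>.finite_measure_axioms ac(2)] by (auto simp: sS sets g_def[abs_def])
  have ind: "integrable S (\<lambda>x. indicator D x * k x)"
    if "D \<in> sets \<mu>" "integrable S k" for D and k :: "_ \<Rightarrow> real"
    using that integrable_mult_indicator[of D S k] by (simp add: sS)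
  have le: "\<bar>measure \<mu> D - measure \<nu> D\<bar> \<le> (\<integral>x. indicator D x * \<bar>f x - g x\<bar> \<partial>S)"
    if D: "D \<in> sets \<mu>" for D
  proof -
    have "measure \<mu> D - measure \<nu> D = (\<integral>x. indicator D x * (f x - g x) \<partial>S)"
      using D f g ind by (simp add: right_diff_distrib)
    also have "\<bar>\<dots>\<bar> \<le> (\<integral>x. \<bar>indicator D x * (f x - g x)\<bar> \<partial>S)"
      by (rule integral_abs_bound)
    finally show ?thesis by (simp add: abs_mult)
  qed
  let ?B' = "space \<mu> - B"
  have B': "?B' \<in> sets \<mu>" using B by simp
  have I: "integrable S (\<lambda>x. \<bar>f x - g x\<bar>)" using f g by simp
  have "(\<integral>x. \<bar>f x - g x\<bar> \<partial>S)
      = (\<integral>x. indicator B x * \<bar>f x - g x\<bar> + indicator ?B' x * \<bar>f x - g x\<bar> \<partial>S)"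
    by (rule Bochner_Integration.integral_cong) (auto simp: indicator_def sS)
  also have "\<dots> = (\<integral>x. indicator B x * \<bar>f x - g x\<bar> \<partial>S) + (\<integral>x. indicator ?B' x * \<bar>f x - g x\<bar> \<partial>S)"
    by (rule Bochner_Integration.integral_add) (rule ind[OF B I] ind[OF B' I])+
  finally have "tv_dist \<mu> \<nu> = 1 / 2 * ((\<integral>x. indicator B x * \<bar>f x - g x\<bar> \<partial>S)
      + (\<integral>x. indicator ?B' x * \<bar>f x - g x\<bar> \<partial>S))"
    by (simp add: tv_dist_def S_def f_def g_def)
  moreover have "measure \<mu> ?B' - measure \<nu> ?B' = - (measure \<mu> B - measure \<nu> B)"
    using B \<mu>.prob_compl[of B] \<nu>.prob_compl[of B] by (simp add: sets sS)
  ultimately show ?thesis using le[OF B] le[OF B'] by simp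
qed

text \<open>With counting measure as reference, the densities are the point masses. The masses at 0
  and at 1 differ by the same amount up to sign, so the sum over both points cancels the factor one
  half.\<close>

lemma tv_dist_bits:
  assumes \<mu>: "prob_space \<mu>" "sets \<mu> = sets bits" and \<nu>: "prob_space \<nu>" "sets \<nu> = sets bits"
  shows "tv_dist \<mu> \<nu> = \<bar>measure \<mu> {1} - measure \<nu> {1}\<bar>"
proof -
  have d: "density bits (\<lambda>y. ennreal (measure \<tau> {y})) = \<tau>"
    if "prob_space \<tau>" and s: "sets \<tau> = sets bits" for \<tau>
  proof (rule measure_eqI_countable[of _ "{0, 1}"])
    interpret prob_space \<tau> by fact
    fix y :: nat assume "y \<in> {0, 1}"
    then show "emeasure (density bits (\<lambda>y. ennreal (measure \<tau> {y}))) {y} = emeasure \<tau> {y}"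
      by (auto simp: emeasure_density nn_integral_count_space_finite emeasure_eq_measure
          indicator_def)
  qed (use s in auto)
  have zero: "measure \<tau> {0} = 1 - measure \<tau> {1}"
    if "prob_space \<tau>" and s: "sets \<tau> = sets bits" for \<tau>
  proof -
    interpret prob_space \<tau> by fact
    have "space \<tau> - {1} = {0}" using sets_eq_imp_space_eq[OF s] by auto
    then show ?thesis using prob_compl[of "{1}"] s by simp
  qed
  have "tv_dist \<mu> \<nu> = 1 / 2 * (\<integral>y. \<bar>measure \<mu> {y} - measure \<nu> {y}\<bar> \<partial>bits)"
    using tv_dist_density[of "\<lambda>y. measure \<mu> {y}" bits "\<lambda>y. measure \<nu> {y}"]
    by (simp add: d[OF \<mu>] d[OF \<nu>] \<mu> \<nu> del: One_nat_def)
  also have "\<dots> = \<bar>measure \<mu> {1} - measure \<nu> {1}\<bar>"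
    using zero[OF \<mu>] zero[OF \<nu>] by (simp add: lebesgue_integral_count_space_finite)
  finally show ?thesis .
qed

section \<open>Conditioning on the group, and classifiers that factor through
  \<open>Z\<close>\<close>

text \<open>Reconciles two encodings of conditioning: \<open>group_dist\<close> renormalises a
  restricted measure, while \<open>stat_parity\<close> uses the quotient of probabilities.\<close>

lemma measure_group_dist:
  assumes M: "prob_space M" and X: "X \<in> M \<rightarrow>\<^sub>M MX" and A: "A \<in> M \<rightarrow>\<^sub>M bits"
    and K: "is_representation MX N K" and B [measurable]: "B \<in> sets N"
  shows "measure (group_dist M X A N K a) B
    = \<P>(w in adjoin M X A N K. snd w \<in> B \<bar> A (fst w) = a)"
proof -
  let ?P = "adjoin M X A N K"
  note P = prob_space_adjoin[OF M X A K]
  have sP [measurable_cong]: "sets ?P = sets (M \<Otimes>\<^sub>M N)"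
    by (rule sets_adjoin[OF M X A K])
  \<comment> \<open>With \<open>UNIV\<close> as codomain, \<open>A = a\<close> is a measurable event
    for every natural number \<open>a\<close>, also outside \<open>{0, 1}\<close>.\<close>
  have [measurable]: "A \<in> M \<rightarrow>\<^sub>M count_space UNIV"
    using A by (rule measurable_compose) simp
  have "measure (group_dist M X A N K a) B
      = \<P>(w in uniform_measure ?P {w \<in> space ?P. A (fst w) = a}. snd w \<in> B)"
    unfolding group_dist_def Let_def
    by (subst measure_distr) (auto intro!: arg_cong[where f = "measure _"])
  also have "\<dots> = \<P>(w in ?P. snd w \<in> B \<bar> A (fst w) = a)"
    by (rule prob_space.measure_uniform_measure_eq_cond_prob[OF P]) measurable
  finally show ?thesis .
qed

text \<open>Conditioning on a null event would give the zero measure; this is where the positivity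
  of both groups enters. It is assumed on \<open>M\<close> and passes to the enlarged space through
  the first marginal.\<close>

lemma prob_space_group_dist:
  assumes M: "prob_space M" and X: "X \<in> M \<rightarrow>\<^sub>M MX" and A: "A \<in> M \<rightarrow>\<^sub>M bits"
    and K: "is_representation MX N K" and pos: "\<P>(\<omega> in M. A \<omega> = a) > 0"
  shows "prob_space (group_dist M X A N K a)" and "sets (group_dist M X A N K a) = sets N"
proof -
  let ?P = "adjoin M X A N K"
  interpret P: prob_space ?P by (rule prob_space_adjoin[OF M X A K])
  have sP [measurable_cong]: "sets ?P = sets (M \<Otimes>\<^sub>M N)"
    by (rule sets_adjoin[OF M X A K])
  have [measurable]: "A \<in> M \<rightarrow>\<^sub>M count_space UNIV"
    using A by (rule measurable_compose) simp
  have "\<P>(\<omega> in M. A \<omega> = a) = measure (distr ?P M fst) {\<omega> \<in> space M. A \<omega> = a}"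
    by (simp add: distr_adjoin_fst[OF M X A K])
  also have "\<dots> = \<P>(w in ?P. A (fst w) = a)"
    by (subst measure_distr) (auto simp: sets_eq_imp_space_eq[OF sP] space_pair_measure
        intro!: arg_cong[where f = "measure _"])
  finally have "P.prob {w \<in> space ?P. A (fst w) = a} > 0" using pos by simp
  then have "prob_space (uniform_measure ?P {w \<in> space ?P. A (fst w) = a})"
    by (intro prob_space_uniform_measure) (auto simp: P.emeasure_eq_measure)
  then show "prob_space (group_dist M X A N K a)"
    unfolding group_dist_def Let_def by (rule prob_space.prob_space_distr) measurable
  show "sets (group_dist M X A N K a) = sets N" by (simp add: group_dist_def Let_def)
qed

lemma stat_parity_eq_group_dist:
  assumes "prob_space M" "X \<in> M \<rightarrow>\<^sub>M MX" "A \<in> M \<rightarrow>\<^sub>M bits" "is_classifier MX C"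
  shows "stat_parity M X A C
    = \<bar>measure (group_dist M X A bits C 1) {1} - measure (group_dist M X A bits C 0) {1}\<bar>"
  using measure_group_dist[OF assms, of "{1}"] by (simp add: stat_parity_def)

text \<open>For \<open>B = {1}\<close> this expresses the statistical parity of the classifier
  obtained by applying \<open>g\<close> to \<open>Z\<close> through the group laws of
  \<open>Z\<close>, evaluated where \<open>g\<close> guesses 1.\<close>

lemma measure_group_dist_distr:
  assumes M: "prob_space M" and X: "X \<in> M \<rightarrow>\<^sub>M MX" and A: "A \<in> M \<rightarrow>\<^sub>M bits"
    and K: "is_representation MX N K" and g [measurable]: "g \<in> N \<rightarrow>\<^sub>M N'"
    and B [measurable]: "B \<in> sets N'"
  shows "measure (group_dist M X A N' (\<lambda>xa. distr (K xa) N' g) a) B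
    = measure (group_dist M X A N K a) (g -` B \<inter> space N)"
proof -
  let ?P = "adjoin M X A N K"
  have sP [measurable_cong]: "sets ?P = sets (M \<Otimes>\<^sub>M N)"
    by (rule sets_adjoin[OF M X A K])
  have [measurable]: "A \<in> M \<rightarrow>\<^sub>M count_space UNIV"
    using A by (rule measurable_compose) simp
  note spP = sets_eq_imp_space_eq[OF sP]
  show ?thesis
    unfolding measure_group_dist[OF M X A is_representation_distr[OF K g] B]
      measure_group_dist[OF M X A K measurable_sets[OF g B]]
      adjoin_distr[OF M X A K g] cond_prob_def
    \<comment> \<open>The two rewritten occurrences are the numerator and the denominator of the
      conditional probability on the left; both are pulled back along the image measure.\<close>
    by (subst (1 2) measure_distr)
      (auto simp: spP space_pair_measure measurable_space[OF g]
        intro!: arg_cong2[where f = "(/)"] arg_cong[where f = "measure _"])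
qed

lemma pred_error_distr:
  assumes M: "prob_space M" and X: "X \<in> M \<rightarrow>\<^sub>M MX" and A: "A \<in> M \<rightarrow>\<^sub>M bits"
    and Y: "Y \<in> M \<rightarrow>\<^sub>M bits"
    and K: "is_representation MX N K" and g [measurable]: "g \<in> N \<rightarrow>\<^sub>M bits"
  shows "pred_error M X A Y (\<lambda>xa. distr (K xa) bits g)
    = \<P>(w in adjoin M X A N K. g (snd w) \<noteq> Y (fst w))"
proof -
  let ?P = "adjoin M X A N K"
  have sP [measurable_cong]: "sets ?P = sets (M \<Otimes>\<^sub>M N)"
    by (rule sets_adjoin[OF M X A K])
  \<comment> \<open>The event of disagreement is a union of two rectangles, one for each value of
    \<open>Y\<close>, hence measurable.\<close>
  have "(Y -` {1} \<inter> space M) \<times> {0} \<union> (Y -` {0} \<inter> space M) \<times> {1} \<in> sets (M \<Otimes>\<^sub>M bits)"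
    by (intro sets.Un pair_measureI measurable_sets[OF Y]) auto
  also have "(Y -` {1} \<inter> space M) \<times> {0} \<union> (Y -` {0} \<inter> space M) \<times> {1}
      = {w \<in> space (M \<Otimes>\<^sub>M bits). snd w \<noteq> Y (fst w)}"
    using measurable_space[OF Y] by (fastforce simp: space_pair_measure)
  finally have "{w \<in> space (M \<Otimes>\<^sub>M bits). snd w \<noteq> Y (fst w)} \<in> sets (M \<Otimes>\<^sub>M bits)" .
  moreover have G: "(\<lambda>(\<omega>, z). (\<omega>, g z)) \<in> ?P \<rightarrow>\<^sub>M M \<Otimes>\<^sub>M bits"
    by measurable
  ultimately show ?thesis
    unfolding pred_error_def adjoin_distr[OF M X A K g]
    by (subst measure_distr[OF G])
      (use measurable_space[OF G] in \<open>auto simp: split_beta intro!: arg_cong[where f = "measure _"]\<close>)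
qed

section \<open>Guessing a binary variable from \<open>Z\<close>\<close>

text \<open>The error event splits by the guess: where \<open>g\<close> says 0 an error means
  \<open>V = 1\<close>, and conversely. Each half has the form
  \<open>Z w \<in> B \<and> V w \<in> E\<close>, whose probability \<open>cond_dist\<close>
  evaluates. As \<open>g\<close> is binary, the natural-number difference \<open>1 - g z\<close> is
  the other label. The integrability claims allow a comparison with \<open>h\<close> by
  monotonicity.\<close>

lemma prob_wrong_guess:
  assumes P: "prob_space P" and Z [measurable]: "Z \<in> P \<rightarrow>\<^sub>M N" and V: "V \<in> P \<rightarrow>\<^sub>M bits"
    and \<kappa>: "cond_dist P V N Z \<kappa>" and g [measurable]: "g \<in> N \<rightarrow>\<^sub>M bits"
  shows "\<P>(w in P. g (Z w) \<noteq> V w) = (\<integral>z. measure (\<kappa> z) {1 - g z} \<partial>distr P N Z)"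
    and "integrable (distr P N Z) (\<lambda>z. measure (\<kappa> z) {1 - g z})"
    and "integrable (distr P N Z) (\<lambda>z. h (\<kappa> z))"
proof -
  interpret P: prob_space P by fact
  interpret L: prob_space "distr P N Z" by (rule P.prob_space_distr) fact
  have [measurable]: "g \<in> N \<rightarrow>\<^sub>M count_space UNIV"
    using g by (rule measurable_compose) simp
  have \<kappa>m [measurable]: "\<kappa> \<in> N \<rightarrow>\<^sub>M prob_algebra bits" using \<kappa> by (simp add: cond_dist_def)
  have pk: "prob_space (\<kappa> z)" if "z \<in> space N" for z
    using measurable_space[OF \<kappa>m that] by (simp add: space_prob_algebra)
  have [measurable]: "(\<lambda>z. measure (\<kappa> z) {0}) \<in> borel_measurable N"
    "(\<lambda>z. measure (\<kappa> z) {1}) \<in> borel_measurable N"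
    by (intro measurable_compose[OF \<kappa>m] measurable_measure_prob_algebra; simp)+
  have g01: "g z = 0 \<or> g z = 1" if "z \<in> space N" for z
    using measurable_space[OF g that] by auto
  \<comment> \<open>In \<open>measure (\<kappa> z) {1 - g z}\<close> the set varies with
    \<open>z\<close>. Distinguishing the two values of \<open>g\<close> leaves fixed sets, for which
    measurability of the kernel suffices.\<close>
  have "(\<lambda>z. if g z = 0 then measure (\<kappa> z) {1} else measure (\<kappa> z) {0}) \<in> borel_measurable N"
    by measurable
  then have m [measurable]: "(\<lambda>z. measure (\<kappa> z) {1 - g z}) \<in> borel_measurable N"
    by (rule measurable_cong[THEN iffD1, rotated]) (use g01 in auto)
  show int: "integrable (distr P N Z) (\<lambda>z. measure (\<kappa> z) {1 - g z})"
    by (rule L.integrable_const_bound[of _ 1])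
      (auto intro!: AE_I2 simp: prob_space.prob_le_1[OF pk] simp del: One_nat_def)
  show "integrable (distr P N Z) (\<lambda>z. h (\<kappa> z))"
    unfolding h_def
    by (rule L.integrable_const_bound[of _ 1])
      (auto intro!: AE_I2 simp: min_def prob_space.prob_le_1[OF pk] simp del: One_nat_def)
  have [measurable]: "(\<lambda>z. emeasure (\<kappa> z) {0}) \<in> borel_measurable N"
    "(\<lambda>z. emeasure (\<kappa> z) {1}) \<in> borel_measurable N"
    by (intro measurable_compose[OF measurable_prob_algebraD[OF \<kappa>m]]
        measurable_emeasure_subprob_algebra; simp)+
  define G where "G b = g -` {b} \<inter> space N" for b
  have G [measurable]: "G b \<in> sets N" for b unfolding G_def by measurable
  have ev: "{w \<in> space P. Z w \<in> B \<and> V w \<in> E} \<in> sets P" if "B \<in> sets N" "E \<subseteq> {0, 1}" for B E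
  proof -
    have "(Z -` B \<inter> space P) \<inter> (V -` E \<inter> space P) \<in> sets P"
      using that by (intro sets.Int measurable_sets[OF V] measurable_sets[OF Z]) auto
    then show ?thesis by (rule back_subst) auto
  qed
  have cd: "emeasure P {w \<in> space P. Z w \<in> B \<and> V w \<in> E}
      = (\<integral>\<^sup>+z\<in>B. emeasure (\<kappa> z) E \<partial>distr P N Z)" if "B \<in> sets N" "E \<subseteq> {0, 1}" for B E
    using \<kappa> that by (simp add: cond_dist_def)
  have "emeasure P {w \<in> space P. g (Z w) \<noteq> V w}
      = emeasure P ({w \<in> space P. Z w \<in> G 0 \<and> V w \<in> {1}} \<union> {w \<in> space P. Z w \<in> G 1 \<and> V w \<in> {0}})"
    using measurable_space[OF Z] measurable_space[OF V] g01
    by (intro arg_cong[where f = "emeasure P"]) (force simp: G_def)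
  also have "\<dots> = emeasure P {w \<in> space P. Z w \<in> G 0 \<and> V w \<in> {1}}
      + emeasure P {w \<in> space P. Z w \<in> G 1 \<and> V w \<in> {0}}"
    by (rule plus_emeasure[symmetric]) (use ev[of "G 0" "{1}"] ev[of "G 1" "{0}"] in auto)
  also have "\<dots> = (\<integral>\<^sup>+z\<in>G 0. emeasure (\<kappa> z) {1} \<partial>distr P N Z)
      + (\<integral>\<^sup>+z\<in>G 1. emeasure (\<kappa> z) {0} \<partial>distr P N Z)"
    using cd[OF G, of "{1}" 0] cd[OF G, of "{0}" 1] by simp
  also have "\<dots> = (\<integral>\<^sup>+z. emeasure (\<kappa> z) {1} * indicator (G 0) z
      + emeasure (\<kappa> z) {0} * indicator (G 1) z \<partial>distr P N Z)"
    by (rule nn_integral_add[symmetric]) measurable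
  also have "\<dots> = (\<integral>\<^sup>+z. ennreal (measure (\<kappa> z) {1 - g z}) \<partial>distr P N Z)"
  proof (rule nn_integral_cong)
    fix z assume "z \<in> space (distr P N Z)"
    then have z: "z \<in> space N" by simp
    interpret k: prob_space "\<kappa> z" by (rule pk[OF z])
    \<comment> \<open>Exactly one of \<open>G 0\<close> and \<open>G 1\<close> contains
      \<open>z\<close>, so only the mass of the wrong label survives.\<close>
    show "emeasure (\<kappa> z) {1} * indicator (G 0) z + emeasure (\<kappa> z) {0} * indicator (G 1) z
        = ennreal (measure (\<kappa> z) {1 - g z})"
      using g01[OF z] z by (auto simp: G_def k.emeasure_eq_measure)
  qed
  also have "\<dots> = ennreal (\<integral>z. measure (\<kappa> z) {1 - g z} \<partial>distr P N Z)"
    by (rule nn_integral_eq_integral[OF int]) simp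
  finally show "\<P>(w in P. g (Z w) \<noteq> V w) = (\<integral>z. measure (\<kappa> z) {1 - g z} \<partial>distr P N Z)"
    by (simp add: P.emeasure_eq_measure Bochner_Integration.integral_nonneg)
qed

text \<open>The complement of \<open>{1}\<close> is \<open>{0}\<close>. This form is symmetric in
  the labels, so \<open>h\<close> is visibly a lower bound for the mass of either one.\<close>

lemma h_eq_min:
  assumes "\<mu> \<in> space (prob_algebra bits)"
  shows "h \<mu> = min (measure \<mu> {1}) (measure \<mu> {0})"
proof -
  interpret prob_space \<mu> using assms by (simp add: space_prob_algebra)
  have s: "sets \<mu> = sets bits" using assms by (simp add: space_prob_algebra)
  have "space \<mu> - {1} = {0}" using sets_eq_imp_space_eq[OF s] by auto
  then show ?thesis using prob_compl[of "{1}"] s by (simp add: h_def)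
qed


theorem lemma3p1:
  fixes M :: "'w measure" and MX :: "'x measure"
    and X :: "'w \<Rightarrow> 'x" and A Y :: "'w \<Rightarrow> nat"
  assumes "prob_space M"
    and "X \<in> M \<rightarrow>\<^sub>M MX"
    and "A \<in> M \<rightarrow>\<^sub>M bits"
    and "Y \<in> M \<rightarrow>\<^sub>M bits"
    and "\<forall>a\<in>{0, 1}. \<P>(\<omega> in M. A \<omega> = a) > 0"
  shows
    "(\<forall>C. is_classifier MX C \<longrightarrow>
       (\<exists>(S :: nat set) K \<kappa>.
          card S = 2 \<and>
          is_representation MX (count_space S) K \<and>
          cond_dist (adjoin M X A (count_space S) K) (\<lambda>w. Y (fst w)) (count_space S) snd \<kappa> \<and>
          (\<integral>z. h (\<kappa> z) \<partial>distr (adjoin M X A (count_space S) K) (count_space S) snd)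
            \<le> pred_error M X A Y C \<and>
          tv_dist (group_dist M X A (count_space S) K 0) (group_dist M X A (count_space S) K 1)
            \<le> stat_parity M X A C))
     \<and>
     (\<forall>(N :: 'z measure) K \<kappa>.
        is_representation MX N K \<and>
        cond_dist (adjoin M X A N K) (\<lambda>w. Y (fst w)) N snd \<kappa> \<longrightarrow>
        (\<exists>g C. g \<in> N \<rightarrow>\<^sub>M bits \<and>
          C = (\<lambda>xa. distr (K xa) bits g) \<and>
          is_classifier MX C \<and>
          pred_error M X A Y C \<le> (\<integral>z. h (\<kappa> z) \<partial>distr (adjoin M X A N K) N snd) \<and>
          stat_parity M X A C \<le> tv_dist (group_dist M X A N K 0) (group_dist M X A N K 1)))"
proof (intro conjI allI impI)
  note M = assms(1) and X = assms(2) and A = assms(3) and Y [measurable] = assms(4)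
  have pos: "\<P>(\<omega> in M. A \<omega> = 0) > 0" "\<P>(\<omega> in M. A \<omega> = 1) > 0" using assms(5) by auto
  fix C assume C: "is_classifier MX C"
  let ?P = "adjoin M X A bits C"
  note P = prob_space_adjoin[OF M X A C]
  have sP [measurable_cong]: "sets ?P = sets (M \<Otimes>\<^sub>M bits)"
    by (rule sets_adjoin[OF M X A C])
  have snd: "snd \<in> ?P \<rightarrow>\<^sub>M bits" and V: "(\<lambda>w. Y (fst w)) \<in> ?P \<rightarrow>\<^sub>M bits" by measurable
  \<comment> \<open>Any version will do: the argument below uses only the defining property of
    \<kappa>.\<close>
  from cond_dist_exists[OF P snd V]
  obtain \<kappa> where \<kappa>: "cond_dist ?P (\<lambda>w. Y (fst w)) bits snd \<kappa>" ..
  note wrong = prob_wrong_guess[OF P snd V \<kappa>, of "\<lambda>z. z", OF measurable_ident_sets[OF refl]]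
  have \<kappa>s: "\<kappa> z \<in> space (prob_algebra bits)" if "z \<in> {0, 1}" for z
    using \<kappa> that by (auto simp: cond_dist_def dest: measurable_space)
  have "(\<integral>z. h (\<kappa> z) \<partial>distr ?P bits snd)
      \<le> (\<integral>z. measure (\<kappa> z) {1 - z} \<partial>distr ?P bits snd)"
  proof (rule integral_mono)
    fix z assume "z \<in> space (distr ?P bits snd)"
    \<comment> \<open>For \<open>z\<close> in \<open>{0, 1}\<close> the label \<open>1 - z\<close>
      is again 0 or 1, so the right-hand side is one of the two masses in the minimum.\<close>
    then show "h (\<kappa> z) \<le> measure (\<kappa> z) {1 - z}"
      by (auto simp: h_eq_min \<kappa>s simp del: One_nat_def)
  qed (fact wrong)+
  also have "\<dots> = pred_error M X A Y C" using wrong by (simp add: pred_error_def)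
  finally have "(\<integral>z. h (\<kappa> z) \<partial>distr ?P bits snd) \<le> pred_error M X A Y C" .
  moreover have "tv_dist (group_dist M X A bits C 0) (group_dist M X A bits C 1)
      \<le> stat_parity M X A C"
    \<comment> \<open>The two sides are in fact equal, up to the order in which the groups are
      subtracted.\<close>
    unfolding stat_parity_eq_group_dist[OF M X A C]
    by (simp only: tv_dist_bits prob_space_group_dist[OF M X A C] pos abs_minus_commute order_refl)
  ultimately show "\<exists>(S :: nat set) K \<kappa>.
      card S = 2 \<and>
      is_representation MX (count_space S) K \<and>
      cond_dist (adjoin M X A (count_space S) K) (\<lambda>w. Y (fst w)) (count_space S) snd \<kappa> \<and>
      (\<integral>z. h (\<kappa> z) \<partial>distr (adjoin M X A (count_space S) K) (count_space S) snd)
        \<le> pred_error M X A Y C \<and>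
      tv_dist (group_dist M X A (count_space S) K 0) (group_dist M X A (count_space S) K 1)
        \<le> stat_parity M X A C"
    using C \<kappa> by (intro exI[of _ "{0, 1}"] exI[of _ C] exI[of _ \<kappa>]) simp
next
  note M = assms(1) and X = assms(2) and A = assms(3) and Y [measurable] = assms(4)
  have pos: "\<P>(\<omega> in M. A \<omega> = 0) > 0" "\<P>(\<omega> in M. A \<omega> = 1) > 0" using assms(5) by auto
  fix N :: "'z measure" and K \<kappa>
  assume "is_representation MX N K \<and> cond_dist (adjoin M X A N K) (\<lambda>w. Y (fst w)) N snd \<kappa>"
  then have K: "is_representation MX N K"
    and \<kappa>: "cond_dist (adjoin M X A N K) (\<lambda>w. Y (fst w)) N snd \<kappa>" by auto
  let ?P = "adjoin M X A N K"
  note P = prob_space_adjoin[OF M X A K]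
  have sP [measurable_cong]: "sets ?P = sets (M \<Otimes>\<^sub>M N)"
    by (rule sets_adjoin[OF M X A K])
  have snd: "snd \<in> ?P \<rightarrow>\<^sub>M N" and V: "(\<lambda>w. Y (fst w)) \<in> ?P \<rightarrow>\<^sub>M bits" by measurable
  have \<kappa>m [measurable]: "\<kappa> \<in> N \<rightarrow>\<^sub>M prob_algebra bits" using \<kappa> by (simp add: cond_dist_def)
  \<comment> \<open>The Bayes guess for the given version \<kappa>. Ties go to 1; either choice
    would attain the minimum.\<close>
  define g where "g z = (if measure (\<kappa> z) {0} \<le> measure (\<kappa> z) {1} then 1 else 0 :: nat)" for z
  have [measurable]: "(\<lambda>z. measure (\<kappa> z) {0}) \<in> borel_measurable N"
    "(\<lambda>z. measure (\<kappa> z) {1}) \<in> borel_measurable N"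
    by (intro measurable_compose[OF \<kappa>m] measurable_measure_prob_algebra; simp)+
  have g [measurable]: "g \<in> N \<rightarrow>\<^sub>M bits" unfolding g_def[abs_def] by measurable
  define C where "C = (\<lambda>xa. distr (K xa) bits g)"
  have C: "is_classifier MX C" unfolding C_def by (rule is_representation_distr[OF K g])
  have "pred_error M X A Y C = \<P>(w in ?P. g (snd w) \<noteq> Y (fst w))"
    unfolding C_def by (rule pred_error_distr[OF M X A Y K g])
  also have "\<dots> = (\<integral>z. measure (\<kappa> z) {1 - g z} \<partial>distr ?P N snd)"
    by (rule prob_wrong_guess(1)[OF P snd V \<kappa> g])
  \<comment> \<open>The label \<open>1 - g z\<close> is one of least mass, so its mass equals
    \<open>h (\<kappa> z)\<close> at every point \<open>z\<close>, and the error bound holds with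
    equality.\<close>
  also have "\<dots> = (\<integral>z. h (\<kappa> z) \<partial>distr ?P N snd)"
    by (rule Bochner_Integration.integral_cong)
      (auto simp: h_eq_min measurable_space[OF \<kappa>m] g_def simp del: One_nat_def)
  finally have error: "pred_error M X A Y C \<le> (\<integral>z. h (\<kappa> z) \<partial>distr ?P N snd)" by simp
  \<comment> \<open>Statistical parity compares the groups only on the event that the guess is 1,
    which is the event \<open>?B\<close> about \<open>Z\<close>.\<close>
  let ?B = "g -` {1} \<inter> space N"
  have "stat_parity M X A C
      = \<bar>measure (group_dist M X A N K 0) ?B - measure (group_dist M X A N K 1) ?B\<bar>"
    unfolding stat_parity_eq_group_dist[OF M X A C]
    by (simp add: C_def measure_group_dist_distr[OF M X A K g] abs_minus_commute del: One_nat_def)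
  also have "\<dots> \<le> tv_dist (group_dist M X A N K 0) (group_dist M X A N K 1)"
    by (rule abs_measure_diff_le_tv_dist)
      (simp_all add: prob_space_group_dist[OF M X A K] pos measurable_sets[OF g] del: One_nat_def)
  finally have "stat_parity M X A C \<le> tv_dist (group_dist M X A N K 0) (group_dist M X A N K 1)" .
  with error show "\<exists>g C. g \<in> N \<rightarrow>\<^sub>M bits \<and>
      C = (\<lambda>xa. distr (K xa) bits g) \<and>
      is_classifier MX C \<and>
      pred_error M X A Y C \<le> (\<integral>z. h (\<kappa> z) \<partial>distr (adjoin M X A N K) N snd) \<and>
      stat_parity M X A C \<le> tv_dist (group_dist M X A N K 0) (group_dist M X A N K 1)"
    using g C C_def by blast
qed

end
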